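(* Let $w,v$ be integers with $2\le w<v$ and $v\ge 2w$. Then an optimal $(\bar{1},1)$-LA$(v;w+1,(w,w,\dots,w,v))$ exists, where the level vector consists of $w$ entries equal to $w$ followed by one entry $v$; i.e. such an array with $v$ rows exists and $v=(\bar1,1)\text{-LAN}(w+1,(w,\dots,w,v))$.
   Context: For positive integers $N,k,t$ with $t<k$ and $v_1,\dots,v_k$, consider $N\times k$ arrays $A=(a_{rj})$ whose $j$-th column has entries from a set $V_j$ with $|V_j|=v_j$. A $t$-way interaction is $T=\{(j,\sigma_j):j\in I\}$ with $I\subseteq\{1,\dots,k\}$, $|I|=t$, $\sigma_j\in V_j$; $\rho(A,T)$ is the set of rows $r$ with $a_{rj}=\sigma_j$ for all $j\in I$, and $\rho(A,\mathcal T)=\bigcup_{T\in\mathcal T}\rho(A,T)$. $A$ is a $(\bar1,t)$-LA$(N;k,(v_1,\dots,v_k))$ if for all sets $\mathcal T_1,\mathcal T_2$ of $t$-way interactions with $|\mathcal T_1|,|\mathcal T_2|\le 1$: $\rho(A,\mathcal T_1)=\rho(A,\mathcal T_2)\iff\mathcal T_1=\mathcal T_2$ (equivalently: every $t$-way interaction occurs in some row and distinct interactions have distinct $\rho$). $(\bar1,t)$-LAN$(k,(v_1,\dots,v_k))$ is the minimum $N$ for which such an array exists; an LA attaining it is optimal. *)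

theory Defs
  imports Main
begin

text \<open>
  An \<open>N \<times> k\<close> array is a function \<open>A\<close> with entry \<open>A r j\<close> for \<open>r < N\<close>, \<open>j < k\<close>; rows and columns are
  numbered from 0, and values outside this range are irrelevant. \<open>V j\<close> is the symbol set of
  column \<open>j\<close>, and the level vector \<open>(v\<^sub>1, \<dots>, v\<^sub>k)\<close> is a list \<open>vs\<close> of length \<open>k\<close>.
\<close>

definition level_sets :: "nat \<Rightarrow> nat list \<Rightarrow> (nat \<Rightarrow> 'a set) \<Rightarrow> bool" where
  "level_sets k vs V \<longleftrightarrow>
     length vs = k \<and> (\<forall>j<k. 0 < vs ! j \<and> finite (V j) \<and> card (V j) = vs ! j)"

definition is_array :: "nat \<Rightarrow> nat \<Rightarrow> (nat \<Rightarrow> 'a set) \<Rightarrow> (nat \<Rightarrow> nat \<Rightarrow> 'a) \<Rightarrow> bool" where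
  "is_array N k V A \<longleftrightarrow> (\<forall>r<N. \<forall>j<k. A r j \<in> V j)"

definition interactions :: "nat \<Rightarrow> nat \<Rightarrow> (nat \<Rightarrow> 'a set) \<Rightarrow> (nat \<times> 'a) set set" where
  "interactions t k V =
     {{(j, \<sigma> j) | j. j \<in> I} | I \<sigma>. I \<subseteq> {..<k} \<and> card I = t \<and> (\<forall>j\<in>I. \<sigma> j \<in> V j)}"

definition rho :: "nat \<Rightarrow> (nat \<Rightarrow> nat \<Rightarrow> 'a) \<Rightarrow> (nat \<times> 'a) set \<Rightarrow> nat set" where
  "rho N A T = {r. r < N \<and> (\<forall>(j, s)\<in>T. A r j = s)}"

definition rho_set :: "nat \<Rightarrow> (nat \<Rightarrow> nat \<Rightarrow> 'a) \<Rightarrow> (nat \<times> 'a) set set \<Rightarrow> nat set" where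
  "rho_set N A \<T> = (\<Union>T\<in>\<T>. rho N A T)"

text \<open>
  \<open>is_LA t N k vs V A\<close>: the array \<open>A\<close> over the symbol sets \<open>V\<close> is a \<open>(1\<close>-bar\<open>, t)\<close>-LA\<open>(N; k, vs)\<close>.
\<close>

definition is_LA ::
  "nat \<Rightarrow> nat \<Rightarrow> nat \<Rightarrow> nat list \<Rightarrow> (nat \<Rightarrow> 'a set) \<Rightarrow> (nat \<Rightarrow> nat \<Rightarrow> 'a) \<Rightarrow> bool" where
  "is_LA t N k vs V A \<longleftrightarrow>
     0 < N \<and> 0 < t \<and> t < k \<and> level_sets k vs V \<and> is_array N k V A \<and>
     (\<forall>\<T>1 \<T>2. \<T>1 \<subseteq> interactions t k V \<and> finite \<T>1 \<and> card \<T>1 \<le> 1 \<and>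
                \<T>2 \<subseteq> interactions t k V \<and> finite \<T>2 \<and> card \<T>2 \<le> 1 \<longrightarrow>
        (rho_set N A \<T>1 = rho_set N A \<T>2 \<longleftrightarrow> \<T>1 = \<T>2))"

text \<open>
  Whether such an array exists depends only on the cardinalities of the symbol sets, so natural
  numbers suffice as symbols here. As usual for \<open>LEAST\<close>, the value is unspecified if there is no
  such array.
\<close>

definition LAN :: "nat \<Rightarrow> nat \<Rightarrow> nat list \<Rightarrow> nat" where
  "LAN t k vs =
     (LEAST N. \<exists>(V :: nat \<Rightarrow> nat set) (A :: nat \<Rightarrow> nat \<Rightarrow> nat). is_LA t N k vs V A)"

definition optimal_LA ::
  "nat \<Rightarrow> nat \<Rightarrow> nat \<Rightarrow> nat list \<Rightarrow> (nat \<Rightarrow> 'a set) \<Rightarrow> (nat \<Rightarrow> nat \<Rightarrow> 'a) \<Rightarrow> bool" where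
  "optimal_LA t N k vs V A \<longleftrightarrow> is_LA t N k vs V A \<and> N = LAN t k vs"

end

theory Submission
  imports Defs
begin

text \<open>
  The last column of the array has all its symbols in distinct rows, so each of its symbols covers
  a single row. In column \<open>j < w\<close> the symbol \<open>s\<close> covers exactly one row below \<open>w\<close>, namely \<open>s\<close>, and
  exactly one row among \<open>w, \<dots>, 2w - 1\<close>, and these edges of the complete bipartite graph
  on \<open>w + w\<close> vertices form a perfect matching for each \<open>j\<close>; the \<open>w\<close> cyclic matchings are pairwise
  disjoint. Hence all covered row sets differ, however the rows from \<open>2w\<close> on are filled.
  Optimality holds since each of the \<open>v\<close> symbols of the last column needs its own row.
\<close>

lemma interactions_1:
  "interactions 1 k V = {{(j, s)} | j s. j < k \<and> s \<in> V j}"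
proof (intro equalityI subsetI)
  fix T assume "T \<in> interactions 1 k V"
  then obtain I \<sigma> where T: "T = {(j, \<sigma> j) | j. j \<in> I}" and I: "I \<subseteq> {..<k}" "card I = 1"
    "\<forall>j\<in>I. \<sigma> j \<in> V j"
    unfolding interactions_def by blast
  from I(2) obtain j where "I = {j}" by (auto simp: card_1_singleton_iff)
  with T I show "T \<in> {{(j, s)} | j s. j < k \<and> s \<in> V j}" by auto
next
  fix T assume "T \<in> {{(j, s)} | j s. j < k \<and> s \<in> V j}"
  then obtain j s where js: "T = {(j, s)}" "j < k" "s \<in> V j" by blast
  then show "T \<in> interactions 1 k V"
    unfolding interactions_def by (intro CollectI exI[of _ "{j}"] exI[of _ "\<lambda>_. s"]) auto
qed

lemma rho_singleton: "rho N A {(j, s)} = {r. r < N \<and> A r j = s}"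
  by (auto simp: rho_def)

lemma is_LA_rho_nonempty:
  assumes "is_LA t N k vs V A" and "T \<in> interactions t k V"
  shows "rho N A T \<noteq> {}"
proof -
  have "\<forall>\<T>1 \<T>2. \<T>1 \<subseteq> interactions t k V \<and> finite \<T>1 \<and> card \<T>1 \<le> 1 \<and>
      \<T>2 \<subseteq> interactions t k V \<and> finite \<T>2 \<and> card \<T>2 \<le> 1 \<longrightarrow>
      (rho_set N A \<T>1 = rho_set N A \<T>2 \<longleftrightarrow> \<T>1 = \<T>2)"
    using assms(1) unfolding is_LA_def by (elim conjE)
  \<comment> \<open>The empty family covers no rows, so \<open>{T}\<close> must cover at least
    one.\<close>
  from this[rule_format, of "{T}" "{}"] assms(2) show ?thesis by (simp add: rho_set_def)
qed

text \<open>A family of size at most 1 is empty or a singleton: nonempty row sets separate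
  \<open>{T}\<close> from the empty family, and injectivity separates two singletons.\<close>

lemma is_LA_I:
  assumes "0 < N" "0 < t" "t < k" "level_sets k vs V" "is_array N k V A"
    and nonempty: "\<And>T. T \<in> interactions t k V \<Longrightarrow> rho N A T \<noteq> {}"
    and inj: "inj_on (rho N A) (interactions t k V)"
  shows "is_LA t N k vs V A"
proof -
  have "rho_set N A \<T>1 = rho_set N A \<T>2 \<longleftrightarrow> \<T>1 = \<T>2"
    if \<T>: "\<T>1 \<subseteq> interactions t k V" "finite \<T>1" "card \<T>1 \<le> 1"
      "\<T>2 \<subseteq> interactions t k V" "finite \<T>2" "card \<T>2 \<le> 1" for \<T>1 \<T>2
  proof -
    have "\<T>1 = {} \<or> (\<exists>T. \<T>1 = {T})" "\<T>2 = {} \<or> (\<exists>T. \<T>2 = {T})"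
      using \<T> by (auto simp: le_Suc_eq card_1_singleton_iff)
    then show ?thesis
      using \<T>(1,4)
      by (elim disjE exE) (simp_all add: rho_set_def nonempty nonempty[symmetric] inj_on_eq_iff[OF inj])
  qed
  with assms(1-5) show ?thesis unfolding is_LA_def by (intro conjI allI impI) simp_all
qed

text \<open>Each symbol of column \<open>j\<close> occurs in some row, so reading that column maps
  the rows onto \<open>V j\<close>.\<close>

lemma is_LA_1_level_le:
  assumes LA: "is_LA 1 N k vs V A" and "j < k"
  shows "vs ! j \<le> N"
proof -
  have card: "card (V j) = vs ! j"
    using assms unfolding is_LA_def level_sets_def by blast
  have "V j \<subseteq> (\<lambda>r. A r j) ` {..<N}"
  proof
    fix s assume "s \<in> V j"
    then have "{(j, s)} \<in> interactions 1 k V" using \<open>j < k\<close> unfolding interactions_1 by blast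
    from is_LA_rho_nonempty[OF LA this] show "s \<in> (\<lambda>r. A r j) ` {..<N}"
      by (auto simp: rho_singleton)
  qed
  from surj_card_le[OF _ this] card show ?thesis by simp
qed

lemma optimal_LA_1I:
  fixes V :: "nat \<Rightarrow> nat set"
  assumes "is_LA 1 N k vs V A" and "j < k" and "vs ! j = N"
  shows "optimal_LA 1 N k vs V A"
proof -
  have "LAN 1 k vs = N"
    unfolding LAN_def
  proof (rule Least_equality)
    show "\<exists>(V :: nat \<Rightarrow> nat set) A. is_LA 1 N k vs V A" using assms(1) by blast
    show "N \<le> M" if "\<exists>(V :: nat \<Rightarrow> nat set) A. is_LA 1 M k vs V A" for M
      using that is_LA_1_level_le[OF _ assms(2)] assms(3) by fastforce
  qed
  then show ?thesis using assms(1) by (simp add: optimal_LA_def)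
qed

definition cyc_symbols :: "nat \<Rightarrow> nat \<Rightarrow> nat \<Rightarrow> nat set" where
  "cyc_symbols w v j = (if j < w then {..<w} else {..<v})"

text \<open>Rows \<open>w\<close> to \<open>2 * w - 1\<close> carry the cyclic matchings. Later rows
  reuse their formula just to get entries below \<open>w\<close>.\<close>

definition cyc_array :: "nat \<Rightarrow> nat \<Rightarrow> nat \<Rightarrow> nat" where
  "cyc_array w r j = (if w \<le> j \<or> r < w then r else (r + j) mod w)"

lemma ex_shifted_residue:
  fixes w j s :: nat
  assumes "j < w" "s < w"
  obtains r where "w \<le> r" "r < 2 * w" "(r + j) mod w = s"
proof
  \<comment> \<open>Here \<open>w - j\<close> replaces the residue of \<open>- j\<close>, avoiding
    truncated subtraction; the leading \<open>w\<close> moves the row into the second block without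
    changing its residue.\<close>
  let ?r = "w + (s + (w - j)) mod w"
  show "w \<le> ?r" "?r < 2 * w" using assms by simp_all
  have "(?r + j) mod w = (s + (w - j) + j) mod w" by (simp add: mod_simps add.assoc)
  also have "\<dots> = s" using assms by simp
  finally show "(?r + j) mod w = s" .
qed

lemma add_mod_left_cancel:
  fixes w r i j :: nat
  assumes "(r + i) mod w = (r + j) mod w" "i < w" "j < w"
  shows "i = j"
proof -
  \<comment> \<open>Over the integers \<open>r\<close> can be subtracted from both sides.\<close>
  have "(int r + int i) mod int w = (int r + int j) mod int w"
    using arg_cong[OF assms(1), of int] by (simp add: zmod_int)
  then have "(int r + int i - int r) mod int w = (int r + int j - int r) mod int w"
    by (rule mod_diff_cong) simp
  then show ?thesis using assms(2,3) by simp
qed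

text \<open>The bound \<open>2 * w \<le> v\<close> ensures that the whole second block lies inside
  the array.\<close>

lemma cyc_array_second_row:
  assumes "2 * w \<le> v" "j < w" "s < w"
  obtains r where "w \<le> r" "r < v" "r \<in> rho v (cyc_array w) {(j, s)}" "(r + j) mod w = s"
proof -
  from assms(2,3) obtain r where "w \<le> r" "r < 2 * w" "(r + j) mod w = s"
    by (rule ex_shifted_residue)
  with assms show ?thesis
    by (intro that[of r]) (auto simp: rho_singleton cyc_array_def)
qed

text \<open>The left set contains row \<open>s\<close> and a row from \<open>w\<close> on, while a
  symbol of the last column occurs in one row only.\<close>

lemma cyc_array_rho_neq_last:
  assumes "2 * w \<le> v" "j < w" "s < w"
  shows "rho v (cyc_array w) {(j, s)} \<noteq> rho v (cyc_array w) {(w, s')}"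
proof
  assume eq: "rho v (cyc_array w) {(j, s)} = rho v (cyc_array w) {(w, s')}"
  from assms obtain r where r: "w \<le> r" "r \<in> rho v (cyc_array w) {(j, s)}"
    by (rule cyc_array_second_row)
  have "s \<in> rho v (cyc_array w) {(j, s)}"
    using assms by (simp add: rho_singleton cyc_array_def)
  then have "s = s'" unfolding eq by (simp add: rho_singleton cyc_array_def)
  moreover have "r = s'" using r(2) unfolding eq by (simp add: rho_singleton cyc_array_def)
  ultimately show False using r(1) assms(3) by simp
qed

text \<open>The row below \<open>w\<close> reveals the symbol; given the symbol, a row of the second
  block reveals the shift, hence the column.\<close>

lemma cyc_array_rho_inj:
  assumes "2 * w \<le> v" "j < w" "s < w" "j' < w" "s' < w"
    and eq: "rho v (cyc_array w) {(j, s)} = rho v (cyc_array w) {(j', s')}"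
  shows "j = j' \<and> s = s'"
proof -
  have "s \<in> rho v (cyc_array w) {(j, s)}"
    using assms(1-3) by (simp add: rho_singleton cyc_array_def)
  then have s: "s = s'" using assms(3,4) unfolding eq by (simp add: rho_singleton cyc_array_def)
  from assms(1-3) obtain r where r: "w \<le> r" "r \<in> rho v (cyc_array w) {(j, s)}"
    "(r + j) mod w = s"
    by (rule cyc_array_second_row)
  then have "(r + j') mod w = s'" using assms(4) unfolding eq
    by (simp add: rho_singleton cyc_array_def)
  with r(3) s have "(r + j) mod w = (r + j') mod w" by simp
  then have "j = j'" using assms(2,4) by (rule add_mod_left_cancel)
  with s show ?thesis by simp
qed

lemma cyc_array_is_LA:
  assumes "1 \<le> w" "2 * w \<le> v"
  shows "is_LA 1 v (w + 1) (replicate w w @ [v]) (cyc_symbols w v) (cyc_array w)"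
proof (rule is_LA_I)
  show "level_sets (w + 1) (replicate w w @ [v]) (cyc_symbols w v)"
    using assms by (auto simp: level_sets_def cyc_symbols_def nth_append)
  show "is_array v (w + 1) (cyc_symbols w v) (cyc_array w)"
    using assms by (auto simp: is_array_def cyc_symbols_def cyc_array_def)
  show "rho v (cyc_array w) T \<noteq> {}" if "T \<in> interactions 1 (w + 1) (cyc_symbols w v)" for T
  proof -
    from that obtain j s where T: "T = {(j, s)}" and js: "j < w + 1" "s \<in> cyc_symbols w v j"
      unfolding interactions_1 by blast
    \<comment> \<open>In every column, the last one included, symbol \<open>s\<close> occurs in row
      \<open>s\<close>.\<close>
    have "s \<in> rho v (cyc_array w) T"
      using js assms
      by (auto simp: T rho_singleton cyc_array_def cyc_symbols_def split: if_splits)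
    then show ?thesis by blast
  qed
  show "inj_on (rho v (cyc_array w)) (interactions 1 (w + 1) (cyc_symbols w v))"
  proof (rule inj_onI)
    fix T T'
    assume "T \<in> interactions 1 (w + 1) (cyc_symbols w v)"
      and "T' \<in> interactions 1 (w + 1) (cyc_symbols w v)"
      and eq: "rho v (cyc_array w) T = rho v (cyc_array w) T'"
    then obtain j s j' s' where T: "T = {(j, s)}" "T' = {(j', s')}"
      and js: "j < w + 1" "s \<in> cyc_symbols w v j" "j' < w + 1" "s' \<in> cyc_symbols w v j'"
      unfolding interactions_1 by blast
    consider "j < w" "j' < w" | "j < w" "j' = w" | "j = w" "j' < w" | "j = w" "j' = w"
      using js by linarith
    then show "T = T'"
    proof cases
      case 1
      then show ?thesis
        using cyc_array_rho_inj[OF assms(2), of j s j' s'] js eq T by (simp add: cyc_symbols_def)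
    next
      case 2
      then show ?thesis
        using cyc_array_rho_neq_last[OF assms(2), of j s s'] js eq T by (simp add: cyc_symbols_def)
    next
      case 3
      then show ?thesis
        using cyc_array_rho_neq_last[OF assms(2), of j' s' s] js eq T by (simp add: cyc_symbols_def)
    next
      case 4
      then have "s \<in> rho v (cyc_array w) T"
        using js by (simp add: T rho_singleton cyc_array_def cyc_symbols_def)
      then have "s = s'" using 4 unfolding eq by (simp add: T rho_singleton cyc_array_def)
      with 4 T show ?thesis by simp
    qed
  qed
qed (use assms in simp_all)

theorem theorem4p20:
  fixes w v :: nat
  assumes "2 \<le> w" and "w < v" and "2 * w \<le> v"
  shows "\<exists>(V :: nat \<Rightarrow> nat set) (A :: nat \<Rightarrow> nat \<Rightarrow> nat).
           optimal_LA 1 v (w + 1) (replicate w w @ [v]) V A"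
proof (intro exI)
  show "optimal_LA 1 v (w + 1) (replicate w w @ [v]) (cyc_symbols w v) (cyc_array w)"
    \<comment> \<open>Column \<open>w\<close> has \<open>v\<close> levels, so it meets the lower
      bound with equality.\<close>
    using assms by (intro optimal_LA_1I[where j = w] cyc_array_is_LA) (simp_all add: nth_append)
qed

end
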